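(* For every positive integer $n$, there exists an $n^2\times n^2$ Sudoku square whose main diagonal and secondary (anti-)diagonal each consist of distinct entries. That is, there is an $n^2\times n^2$ array with entries in $\{1,\dots,n^2\}$ such that the entries are pairwise distinct within each row, within each column, within each of the $n^2$ blocks, within the main diagonal (the cells in positions $(k,k)$, $1\le k\le n^2$), and within the secondary diagonal (the cells in positions $(k,n^2+1-k)$, $1\le k\le n^2$).
   Context: An $n^2\times n^2$ grid is partitioned into $n^2$ blocks, each an $n\times n$ sub-grid: for $1\le i,j\le n$, the $(i,j)$-block consists of the cells in rows $(i-1)n+1,\dots,in$ and columns $(j-1)n+1,\dots,jn$. An $n^2\times n^2$ Sudoku square is a filling of this grid with the integers $1,\dots,n^2$ such that each row, each column, and each block contains distinct entries (equivalently, each of the $n^2$ integers exactly once). *)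

theory Defs
  imports Main
begin

(* Arrays are total functions row => column => entry with 1-based indices; only the values on
   {1..n^2} x {1..n^2} matter. Block indices i, j start at 1, so (i - 1) does not truncate. *)

definition sudoku_block :: "nat \<Rightarrow> nat \<Rightarrow> nat \<Rightarrow> (nat \<times> nat) set" where
  "sudoku_block n i j = {(i - 1) * n + 1..i * n} \<times> {(j - 1) * n + 1..j * n}"

definition sudoku_square :: "nat \<Rightarrow> (nat \<Rightarrow> nat \<Rightarrow> nat) \<Rightarrow> bool" where
  "sudoku_square n A \<longleftrightarrow>
     (\<forall>r\<in>{1..n^2}. \<forall>c\<in>{1..n^2}. A r c \<in> {1..n^2}) \<and>
     (\<forall>r\<in>{1..n^2}. inj_on (\<lambda>c. A r c) {1..n^2}) \<and>
     (\<forall>c\<in>{1..n^2}. inj_on (\<lambda>r. A r c) {1..n^2}) \<and>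
     (\<forall>i\<in>{1..n}. \<forall>j\<in>{1..n}. inj_on (\<lambda>(r, c). A r c) (sudoku_block n i j))"

definition distinct_main_diagonal :: "nat \<Rightarrow> (nat \<Rightarrow> nat \<Rightarrow> nat) \<Rightarrow> bool" where
  "distinct_main_diagonal n A \<longleftrightarrow> inj_on (\<lambda>k. A k k) {1..n^2}"

definition distinct_secondary_diagonal :: "nat \<Rightarrow> (nat \<Rightarrow> nat \<Rightarrow> nat) \<Rightarrow> bool" where
  "distinct_secondary_diagonal n A \<longleftrightarrow> inj_on (\<lambda>k. A k (n^2 + 1 - k)) {1..n^2}"

end

(* Count rows and columns from 0 and write them in base n as (a, b) and (c, d), so that (a, c) is
   the block. Take the entry with base-n digits (a + d, b + c + d) mod n. All five distinctness
   conditions are the injectivity of an integer linear map (affine for the secondary diagonal,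
   where c = -1 - a and d = -1 - b) of determinant 1 or -1, hence hold modulo every n. *)

theory Submission
  imports Defs "HOL-Number_Theory.Cong"
begin

definition entry :: "nat \<Rightarrow> nat \<Rightarrow> nat \<Rightarrow> nat" where
  "entry n u v =
     n * ((u div n + v mod n) mod n) + (u mod n + v div n + v mod n) mod n"

lemma radix_pair_less:
  fixes n p q :: nat
  assumes "p < n" "q < n"
  shows "n * p + q < n\<^sup>2"
proof -
  have "n * p + q < n * Suc p" using assms by simp
  also have "\<dots> \<le> n * n" using assms by (intro mult_le_mono2) simp
  finally show ?thesis by (simp add: power2_eq_square)
qed

lemma entry_less: "n > 0 \<Longrightarrow> entry n u v < n\<^sup>2"
  unfolding entry_def by (intro radix_pair_less) simp_all

text \<open>Since both summands of \<open>entry\<close> are reduced modulo \<open>n\<close>,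
  division with remainder by \<open>n\<close> recovers them as digits. Each injectivity claim
  thereby becomes a pair of linear congruences.\<close>

lemma entry_eqD:
  assumes "n > 0" "entry n u v = entry n u' v'"
  shows "[u div n + v mod n = u' div n + v' mod n] (mod n)"
    and "[u mod n + v div n + v mod n = u' mod n + v' div n + v' mod n] (mod n)"
proof -
  have "entry n u v div n = entry n u' v' div n" "entry n u v mod n = entry n u' v' mod n"
    using assms by simp_all
  then show "[u div n + v mod n = u' div n + v' mod n] (mod n)"
    "[u mod n + v div n + v mod n = u' mod n + v' div n + v' mod n] (mod n)"
    using \<open>n > 0\<close> unfolding entry_def cong_def by simp_all
qed

lemma div_less_of_less_square: "u < n\<^sup>2 \<Longrightarrow> u div n < (n::nat)"
  by (simp add: less_mult_imp_div_less power2_eq_square)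

lemma eq_if_div_mod_eq: "u div n = v div n \<Longrightarrow> u mod n = v mod n \<Longrightarrow> u = (v::nat)"
  by (metis div_mult_mod_eq)

text \<open>Both base-\<open>n\<close> digits of \<open>n\<^sup>2 - 1\<close> equal
  \<open>n - 1\<close>, so subtracting \<open>u\<close> from it never borrows and acts digit by
  digit.\<close>

lemma div_mod_reflect:
  fixes n u :: nat
  assumes "u < n\<^sup>2"
  shows "(n\<^sup>2 - 1 - u) div n = n - 1 - u div n" and "(n\<^sup>2 - 1 - u) mod n = n - 1 - u mod n"
proof -
  have n: "n > 0" using assms by (cases n) auto
  have a: "u div n < n" and b: "u mod n < n"
    using assms n by (simp_all add: div_less_of_less_square)
  \<comment> \<open>\<open>p\<close> and \<open>q\<close> are the complementary digits; introducing
    them through sums keeps truncated subtraction out of the computation.\<close>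
  obtain p where p: "n = Suc (u div n + p)" using a less_iff_Suc_add by auto
  obtain q where q: "n = Suc (u mod n + q)" using b less_iff_Suc_add by auto
  have "u + (n * p + q) + 1 = n * (u div n) + u mod n + n * p + q + 1" by simp
  also have "\<dots> = n * (u div n + p) + Suc (u mod n + q)" by (simp add: distrib_left)
  also have "\<dots> = n * (u div n + p) + n" using q by simp
  also have "\<dots> = n * Suc (u div n + p)" by simp
  also have "\<dots> = n\<^sup>2" using p by (simp add: power2_eq_square)
  finally have "n\<^sup>2 - 1 - u = n * p + q" by simp
  moreover have "p = n - 1 - u div n" "q = n - 1 - u mod n" using p q by linarith+
  moreover have "q < n" using q by linarith
  ultimately show "(n\<^sup>2 - 1 - u) div n = n - 1 - u div n"
    "(n\<^sup>2 - 1 - u) mod n = n - 1 - u mod n" by simp_all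
qed

text \<open>With a and b fixed, the digit a + d determines d, and then b + c + d determines
  c.\<close>

lemma entry_row_inj:
  assumes "n > 0" "v < n\<^sup>2" "v' < n\<^sup>2" "entry n u v = entry n u v'"
  shows "v = v'"
proof (rule eq_if_div_mod_eq)
  note e = entry_eqD[OF assms(1,4)]
  show m: "v mod n = v' mod n"
    using e(1) by (simp add: cong_add_lcancel_nat) (simp add: cong_def)
  have "[v div n = v' div n] (mod n)"
    using e(2) m by (simp add: cong_add_lcancel_nat cong_add_rcancel_nat)
  then show "v div n = v' div n"
    using assms(2,3) div_less_of_less_square cong_less_modulus_unique_nat by blast
qed

text \<open>With c and d fixed, the two digits are translates of a and of b modulo
  \<open>n\<close>.\<close>

lemma entry_column_inj:
  assumes "n > 0" "u < n\<^sup>2" "u' < n\<^sup>2" "entry n u v = entry n u' v"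
  shows "u = u'"
proof (rule eq_if_div_mod_eq)
  note e = entry_eqD[OF assms(1,4)]
  show "u mod n = u' mod n"
    using e(2) by (simp add: cong_add_rcancel_nat) (simp add: cong_def)
  have "[u div n = u' div n] (mod n)"
    using e(1) by (simp add: cong_add_rcancel_nat)
  then show "u div n = u' div n"
    using assms(2,3) div_less_of_less_square cong_less_modulus_unique_nat by blast
qed

text \<open>With a and c fixed, a + d determines d, and then b + c + d determines b.\<close>

lemma entry_block_inj:
  assumes "n > 0" "u div n = u' div n" "v div n = v' div n" "entry n u v = entry n u' v'"
  shows "u = u'" and "v = v'"
proof -
  note e = entry_eqD[OF assms(1,4)]
  have m: "v mod n = v' mod n"
    using e(1) assms(2) by (simp add: cong_add_lcancel_nat) (simp add: cong_def)
  then show "v = v'" using assms(3) eq_if_div_mod_eq by blast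
  have "u mod n = u' mod n"
    using e(2) m assms(3) by (simp add: cong_add_rcancel_nat) (simp add: cong_def)
  then show "u = u'" using assms(2) eq_if_div_mod_eq by blast
qed

text \<open>Here c = a and d = b, so the digits are a + b and a + 2b. Their difference is b, and
  then a follows; nothing is divided by 2, so even \<open>n\<close> causes no trouble.\<close>

lemma entry_main_diagonal_inj:
  assumes "n > 0" "u < n\<^sup>2" "u' < n\<^sup>2" "entry n u u = entry n u' u'"
  shows "u = u'"
proof (rule eq_if_div_mod_eq)
  note e = entry_eqD[OF assms(1,4)]
  \<comment> \<open>Subtracting the first congruence from the second, done additively: a' + b' is
    replaced by the congruent a + b, which then cancels.\<close>
  have "[(u div n + u mod n) + u mod n = (u div n + u mod n) + u' mod n] (mod n)"
  proof -
    have "[(u div n + u mod n) + u mod n = (u' div n + u' mod n) + u' mod n] (mod n)"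
      using e(2) by (simp add: add.commute add.left_commute)
    also have "[(u' div n + u' mod n) + u' mod n = (u div n + u mod n) + u' mod n] (mod n)"
      by (rule cong_add[OF cong_sym[OF e(1)] cong_refl])
    finally show ?thesis .
  qed
  then have "[u mod n = u' mod n] (mod n)" by (simp only: cong_add_lcancel_nat)
  then show m: "u mod n = u' mod n" by (simp add: cong_def)
  have "[u div n = u' div n] (mod n)"
    using e(1) m by (simp add: cong_add_rcancel_nat)
  then show "u div n = u' div n"
    using assms(2,3) div_less_of_less_square cong_less_modulus_unique_nat by blast
qed

text \<open>Here c = n - 1 - a and d = n - 1 - b, so b drops out of the low digit b + c + d. That
  digit yields a first, and the high digit a + d then yields b.\<close>

lemma entry_secondary_diagonal_inj:
  assumes "n > 0" "u < n\<^sup>2" "u' < n\<^sup>2"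
    and "entry n u (n\<^sup>2 - 1 - u) = entry n u' (n\<^sup>2 - 1 - u')"
  shows "u = u'"
proof (rule eq_if_div_mod_eq)
  note e = entry_eqD[OF assms(1,4), unfolded div_mod_reflect[OF assms(2)]
      div_mod_reflect[OF assms(3)]]
  have a: "u div n < n" "u' div n < n" using assms div_less_of_less_square by blast+
  have b: "u mod n < n" "u' mod n < n" using assms(1) by simp_all
  \<comment> \<open>Used with \<open>w\<close> = b and \<open>t\<close> = n - 1 - a to cancel b; the
    bound on \<open>w\<close> keeps the subtraction from truncating.\<close>
  have r: "w + t + (n - 1 - w) = (n - 1) + t" if "w < n" for w t using that by simp
  have "[n - 1 - u div n = n - 1 - u' div n] (mod n)"
    using e(2) unfolding r[OF b(1)] r[OF b(2)] by (simp only: cong_add_lcancel_nat)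
  moreover have "n - 1 - u div n < n" "n - 1 - u' div n < n" using assms(1) by simp_all
  ultimately have "n - 1 - u div n = n - 1 - u' div n"
    using cong_less_modulus_unique_nat by blast
  then show d: "u div n = u' div n" using a by linarith
  have "[n - 1 - u mod n = n - 1 - u' mod n] (mod n)"
    using e(1) unfolding d by (simp only: cong_add_lcancel_nat)
  moreover have "n - 1 - u mod n < n" "n - 1 - u' mod n < n" using assms(1) by simp_all
  ultimately have "n - 1 - u mod n = n - 1 - u' mod n"
    using cong_less_modulus_unique_nat by blast
  then show "u mod n = u' mod n" using b by linarith
qed

text \<open>The shift to indices from 0 turns a strip of \<open>n\<close> consecutive rows or
  columns into a class of constant quotient, the form in which \<open>entry_block_inj\<close>
  expects a block.\<close>

lemma block_coordinate_div:
  fixes n i r :: nat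
  assumes "i \<ge> 1" "r \<in> {(i - 1) * n + 1..i * n}"
  shows "(r - 1) div n = i - 1"
proof -
  obtain k where "i = Suc k" using assms(1) by (cases i) auto
  then show ?thesis using assms(2) by (intro div_nat_eqI) (auto simp: mult.commute)
qed

theorem theorem2:
  fixes n :: nat
  assumes "n \<ge> 1"
  shows "\<exists>A. sudoku_square n A \<and> distinct_main_diagonal n A \<and> distinct_secondary_diagonal n A"
proof (intro exI conjI)
  \<comment> \<open>The predecessors pass to indices from 0, and \<open>Suc\<close> moves the values
    from 0..n^2 - 1 to 1..n^2.\<close>
  let ?A = "\<lambda>r c. Suc (entry n (r - 1) (c - 1))"
  have n: "n > 0" using assms by simp
  have pred_less: "r - 1 < n\<^sup>2" if "r \<in> {1..n\<^sup>2}" for r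
    using that by auto
  \<comment> \<open>On naturals \<open>0 - 1 = 1 - 1\<close>, hence the lower bounds.\<close>
  have pred_inj: "r = r'" if "r - 1 = r' - 1" "r \<ge> 1" "r' \<ge> 1" for r r' :: nat
    using that by linarith
  have blocks: "inj_on (\<lambda>(r, c). ?A r c) (sudoku_block n i j)" if "i \<in> {1..n}" "j \<in> {1..n}" for i j
  proof (rule inj_onI, unfold split_paired_all prod.case)
    fix r c r' c'
    assume "(r, c) \<in> sudoku_block n i j" "(r', c') \<in> sudoku_block n i j"
    then have r: "r \<in> {(i - 1) * n + 1..i * n}" "r' \<in> {(i - 1) * n + 1..i * n}"
      and c: "c \<in> {(j - 1) * n + 1..j * n}" "c' \<in> {(j - 1) * n + 1..j * n}"
      by (simp_all add: sudoku_block_def)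
    assume "?A r c = ?A r' c'"
    then have "entry n (r - 1) (c - 1) = entry n (r' - 1) (c' - 1)" by simp
    moreover have "(r - 1) div n = (r' - 1) div n" "(c - 1) div n = (c' - 1) div n"
      using that r[THEN block_coordinate_div[rotated]] c[THEN block_coordinate_div[rotated]]
      by simp_all
    ultimately have "r - 1 = r' - 1" "c - 1 = c' - 1"
      by (metis entry_block_inj[OF n])+
    then show "(r, c) = (r', c')" using pred_inj[of r r'] pred_inj[of c c'] r c by simp
  qed
  have rows: "inj_on (\<lambda>c. ?A r c) {1..n\<^sup>2}" for r
  proof (rule inj_onI)
    fix c c' assume *: "c \<in> {1..n\<^sup>2}" "c' \<in> {1..n\<^sup>2}" "?A r c = ?A r c'"
    show "c = c'"
      by (rule pred_inj[OF entry_row_inj[where u = "r - 1", OF n pred_less pred_less]])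
        (use * in simp_all)
  qed
  have columns: "inj_on (\<lambda>r. ?A r c) {1..n\<^sup>2}" for c
  proof (rule inj_onI)
    fix r r' assume *: "r \<in> {1..n\<^sup>2}" "r' \<in> {1..n\<^sup>2}" "?A r c = ?A r' c"
    show "r = r'"
      by (rule pred_inj[OF entry_column_inj[where v = "c - 1", OF n pred_less pred_less]])
        (use * in simp_all)
  qed
  have entries: "?A r c \<in> {1..n\<^sup>2}" for r c
    using entry_less[OF n] by (simp add: Suc_le_eq)
  show "sudoku_square n ?A"
    unfolding sudoku_square_def by (intro conjI ballI entries rows columns blocks)
  show "distinct_main_diagonal n ?A"
    unfolding distinct_main_diagonal_def
  proof (rule inj_onI)
    fix k k' assume *: "k \<in> {1..n\<^sup>2}" "k' \<in> {1..n\<^sup>2}" "?A k k = ?A k' k'"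
    show "k = k'"
      by (rule pred_inj[OF entry_main_diagonal_inj[OF n pred_less pred_less]])
        (use * in simp_all)
  qed
  show "distinct_secondary_diagonal n ?A"
    unfolding distinct_secondary_diagonal_def
  proof (rule inj_onI)
    fix k k' assume k: "k \<in> {1..n\<^sup>2}" "k' \<in> {1..n\<^sup>2}"
      and eq: "?A k (n\<^sup>2 + 1 - k) = ?A k' (n\<^sup>2 + 1 - k')"
    \<comment> \<open>Counted from 0, the secondary diagonal meets row u in column n^2 - 1 - u; the
      range of \<open>k\<close> rules out truncation.\<close>
    have "n\<^sup>2 + 1 - k - 1 = n\<^sup>2 - 1 - (k - 1)" "n\<^sup>2 + 1 - k' - 1 = n\<^sup>2 - 1 - (k' - 1)"
      using k by auto
    then have "entry n (k - 1) (n\<^sup>2 - 1 - (k - 1)) = entry n (k' - 1) (n\<^sup>2 - 1 - (k' - 1))"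
      using eq by simp
    then have "k - 1 = k' - 1"
      by (rule entry_secondary_diagonal_inj[OF n pred_less[OF k(1)] pred_less[OF k(2)]])
    then show "k = k'" using k pred_inj[of k k'] by simp
  qed
qed

end
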